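(* Let $G = N \rtimes H$ be an isometry group constructed as an outer semidirect product of a normal subgroup $N$ and a subgroup $H$. Identify $n \in N$ with $(n,e_H) \in G$ and $h \in H$ with $(e_N,h) \in G$. Then: (a) any direct isometry of $H$ is a direct isometry of $G$; (b) any direct isometry of $N$ is a direct isometry of $G$.
   Context: An isometry group is a group of isometries of some space; no assumption is made on the space, and the invariance defining its isometries need not come from a true metric, so only the group structure matters. An element of an isometry group $\Gamma$ is called a direct isometry of $\Gamma$ when it can be expressed as a (finite) product of squares of elements of $\Gamma$; otherwise it is called an indirect isometry of $\Gamma$. Thus directness is always relative to a specified group. The outer semidirect product $N \rtimes H$ is taken with respect to a homomorphism $\phi: H \to \mathrm{Aut}(N)$, $h \mapsto \phi_h$; its elements are pairs $(n,h)$ with $n\in N$, $h\in H$ and its operation is $(n_1,h_1)(n_2,h_2) = (n_1\,\phi_{h_1}(n_2),\, h_1h_2)$. The neutral elements of $N$ and $H$ are $e_N$ and $e_H$. *)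

theory Defs
  imports "HOL-Algebra.Algebra"
begin

text \<open>
  An isometry group enters only through its group structure, so it is represented by an
  arbitrary group. Being a direct isometry is relative to the group \<open>G\<close>: the factors squared
  must be elements of \<open>G\<close>. The empty product is the neutral element, which is itself a square.
\<close>

definition direct_isometry :: "('a, 'b) monoid_scheme \<Rightarrow> 'a \<Rightarrow> bool" where
  "direct_isometry G g \<longleftrightarrow> g \<in> carrier G \<and>
     (\<exists>xs. set xs \<subseteq> carrier G \<and>
        g = foldr (\<otimes>\<^bsub>G\<^esub>) (map (\<lambda>x. x [^]\<^bsub>G\<^esub> (2::nat)) xs) \<one>\<^bsub>G\<^esub>)"

definition semidirect_product ::
  "('n, 'b) monoid_scheme \<Rightarrow> ('h, 'c) monoid_scheme \<Rightarrow> ('h \<Rightarrow> 'n \<Rightarrow> 'n) \<Rightarrow> ('n \<times> 'h) monoid" where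
  "semidirect_product N H \<phi> =
     \<lparr>carrier = carrier N \<times> carrier H,
      monoid.mult = (\<lambda>(n\<^sub>1, h\<^sub>1) (n\<^sub>2, h\<^sub>2). (n\<^sub>1 \<otimes>\<^bsub>N\<^esub> \<phi> h\<^sub>1 n\<^sub>2, h\<^sub>1 \<otimes>\<^bsub>H\<^esub> h\<^sub>2)),
      one = (\<one>\<^bsub>N\<^esub>, \<one>\<^bsub>H\<^esub>)\<rparr>"

lemma semidirect_product_group:
  assumes "group N" "group H" and \<phi>: "\<phi> \<in> hom H (AutoGroup N)"
  shows "group (semidirect_product N H \<phi>)"
proof -
  interpret N: group N by fact
  interpret H: group H by fact
  interpret A: group "AutoGroup N" by (rule N.AutoGroup)
  interpret \<phi>: group_hom H "AutoGroup N" \<phi> by unfold_locales (rule \<phi>)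
  have au: "\<phi> h \<in> auto N" if "h \<in> carrier H" for h
    using \<phi>.hom_closed[OF that] by (simp add: AutoGroup_def)
  have cl: "\<phi> h n \<in> carrier N" if "h \<in> carrier H" "n \<in> carrier N" for h n
    using au[OF that(1)] that(2) by (auto simp: auto_def hom_def)
  have mu: "\<phi> h (n \<otimes>\<^bsub>N\<^esub> m) = \<phi> h n \<otimes>\<^bsub>N\<^esub> \<phi> h m"
    if "h \<in> carrier H" "n \<in> carrier N" "m \<in> carrier N" for h n m
    using au[OF that(1)] that(2,3) by (auto simp: auto_def hom_def)
  have co: "\<phi> (h \<otimes>\<^bsub>H\<^esub> k) n = \<phi> h (\<phi> k n)"
    if "h \<in> carrier H" "k \<in> carrier H" "n \<in> carrier N" for h k n
    using \<phi>.hom_mult[OF that(1,2)] au[OF that(1)] au[OF that(2)] that(3)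
    by (simp add: AutoGroup_def BijGroup_def auto_def compose_eq)
  have id: "\<phi> \<one>\<^bsub>H\<^esub> n = n" if "n \<in> carrier N" for n
    using \<phi>.hom_one that by (simp add: AutoGroup_def BijGroup_def)
  show ?thesis
  proof (rule groupI)
    fix x assume "x \<in> carrier (semidirect_product N H \<phi>)"
    then obtain n h where x: "x = (n, h)" "n \<in> carrier N" "h \<in> carrier H"
      by (auto simp: semidirect_product_def)
    let ?y = "(\<phi> (inv\<^bsub>H\<^esub> h) (inv\<^bsub>N\<^esub> n), inv\<^bsub>H\<^esub> h)"
    have "\<phi> (inv\<^bsub>H\<^esub> h) (inv\<^bsub>N\<^esub> n) \<otimes>\<^bsub>N\<^esub> \<phi> (inv\<^bsub>H\<^esub> h) n = \<one>\<^bsub>N\<^esub>"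
      using x mu[of "inv\<^bsub>H\<^esub> h" "inv\<^bsub>N\<^esub> n" n] mu[of "inv\<^bsub>H\<^esub> h" "\<one>\<^bsub>N\<^esub>" "\<one>\<^bsub>N\<^esub>"] cl[of "inv\<^bsub>H\<^esub> h" "\<one>\<^bsub>N\<^esub>"]
      by simp
    then show "\<exists>y\<in>carrier (semidirect_product N H \<phi>).
        y \<otimes>\<^bsub>semidirect_product N H \<phi>\<^esub> x = \<one>\<^bsub>semidirect_product N H \<phi>\<^esub>"
      using x by (intro bexI[of _ ?y]) (simp_all add: semidirect_product_def cl del: \<phi>.hom_inv)
  qed (auto simp: semidirect_product_def cl mu co id N.m_assoc H.m_assoc
      simp del: \<phi>.hom_mult \<phi>.hom_one)
qed

end

theory Submission
  imports Defs
begin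

text \<open>A homomorphism sends squares to squares and products to products, hence direct
  isometries to direct isometries (\<open>direct_isometry_hom\<close>). Both claims follow once the
  two identifications with subsets of \<open>G\<close> are seen to be homomorphisms. For H this
  rests on each automorphism \<phi> h fixing the neutral element of N, for N on \<phi> sending the
  neutral element of H to the identity map.\<close>

lemma (in group_hom) direct_isometry_hom:
  assumes "direct_isometry G g"
  shows "direct_isometry H (h g)"
proof -
  let ?sq = "\<lambda>K xs. foldr (\<otimes>\<^bsub>K\<^esub>) (map (\<lambda>x. x [^]\<^bsub>K\<^esub> (2::nat)) xs) \<one>\<^bsub>K\<^esub>"
  obtain xs where g: "g \<in> carrier G" and xs: "set xs \<subseteq> carrier G" and eq: "g = ?sq G xs"
    using assms by (auto simp: direct_isometry_def)
  \<comment> \<open>Membership in the carrier is carried through the induction because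
    \<open>h\<close> is multiplicative only there.\<close>
  from xs have "?sq G xs \<in> carrier G \<and> h (?sq G xs) = ?sq H (map h xs)"
    by (induction xs) (simp_all add: hom_nat_pow)
  with eq have "h g = ?sq H (map h xs)"
    by simp
  moreover have "h g \<in> carrier H" and "set (map h xs) \<subseteq> carrier H"
    using g xs by auto
  ultimately show ?thesis
    unfolding direct_isometry_def by blast
qed

theorem theorem2:
  fixes N :: "('n, 'b) monoid_scheme"
    and H :: "('h, 'c) monoid_scheme"
    and \<phi> :: "'h \<Rightarrow> 'n \<Rightarrow> 'n"
    and G :: "('n \<times> 'h) monoid"
  assumes "group N"
    and "group H"
    and "\<phi> \<in> hom H (AutoGroup N)"
    and "G = semidirect_product N H \<phi>"
  shows "(\<forall>h. direct_isometry H h \<longrightarrow> direct_isometry G (\<one>\<^bsub>N\<^esub>, h)) \<and>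
         (\<forall>n. direct_isometry N n \<longrightarrow> direct_isometry G (n, \<one>\<^bsub>H\<^esub>))"
proof -
  interpret N: group N by fact
  interpret H: group H by fact
  interpret G: group G
    using semidirect_product_group[OF assms(1-3)] assms(4) by simp
  interpret A: group "AutoGroup N" by (rule N.AutoGroup)
  interpret \<phi>: group_hom H "AutoGroup N" \<phi> by unfold_locales fact
  have \<phi>_one: "\<phi> h \<one>\<^bsub>N\<^esub> = \<one>\<^bsub>N\<^esub>" if "h \<in> carrier H" for h
  proof -
    have "\<phi> h \<in> hom N N"
      using \<phi>.hom_closed[OF that] by (simp add: AutoGroup_def auto_def)
    then show ?thesis
      using N.group_axioms by (rule hom_one) (rule N.group_axioms)
  qed
  \<comment> \<open>The neutral element of \<open>AutoGroup N\<close> is the identity restricted to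
    \<open>carrier N\<close>, hence the condition on \<open>n\<close>.\<close>
  have one_\<phi>: "\<phi> \<one>\<^bsub>H\<^esub> n = n" if "n \<in> carrier N" for n
    using \<phi>.hom_one that by (simp add: AutoGroup_def BijGroup_def)
  \<comment> \<open>In \<open>G\<close>, (1, h)(1, k) = (1 \<phi>_h(1), hk), so
    \<open>\<phi>_one\<close> gives (1, hk).\<close>
  have "(\<lambda>h. (\<one>\<^bsub>N\<^esub>, h)) \<in> hom H G"
    unfolding assms(4) by (rule homI) (simp_all add: semidirect_product_def \<phi>_one)
  then interpret iH: group_hom H G "\<lambda>h. (\<one>\<^bsub>N\<^esub>, h)"
    by (intro group_hom.intro group_hom_axioms.intro H.group_axioms G.group_axioms)
  \<comment> \<open>Here (n, 1)(m, 1) = (n \<phi>_1(m), 1), and \<open>one_\<phi>\<close> turns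
    \<phi>_1(m) into m. The simp rule \<open>\<phi>.hom_one\<close> is removed since it would
    rewrite \<phi>_1 to the unit of \<open>AutoGroup N\<close> before \<open>one_\<phi>\<close>
    could match.\<close>
  have "(\<lambda>n. (n, \<one>\<^bsub>H\<^esub>)) \<in> hom N G"
    unfolding assms(4)
    by (rule homI) (simp_all add: semidirect_product_def one_\<phi> del: \<phi>.hom_one)
  then interpret iN: group_hom N G "\<lambda>n. (n, \<one>\<^bsub>H\<^esub>)"
    by (intro group_hom.intro group_hom_axioms.intro N.group_axioms G.group_axioms)
  show ?thesis
    using iH.direct_isometry_hom iN.direct_isometry_hom by blast
qed

end
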